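(* Consider $N$ agents with local cost functions $f_{i,t}$ and communication graph $\mathcal{G}$ as in the context, $f_t(x)=\sum_{i=1}^N f_{i,t}(x)$ for $x\in\mathbb{R}^n$, and $F_t(\mathbf{x})=\sum_{i=1}^N f_{i,t}(\mathbf{x}_i)$ for $\mathbf{x}=[\mathbf{x}_1^T,\dots,\mathbf{x}_N^T]^T\in\mathbb{R}^{Nn}$. Assume: (B1) for every $t\ge T_0$ a minimizer $x_t^*$ of $f_t$ over $\mathbb{R}^n$ exists and $\|x_t^*\|\le c_0'$ for a constant $c_0'>0$ independent of $t$; (B2) for every $T>T_0$ a minimizer $\tilde x(T)\in\operatorname{argmin}_{x\in\mathbb{R}^n}\int_{T_0}^T f_t(x)\,dt$ exists and is bounded by a constant independent of $T$; (B3) for every $i$ and $t\ge T_0$ a minimizer $\mathbf{x}_i^\dagger(t)$ of $f_{i,t}$ over $\mathbb{R}^n$ exists and $\|\mathbf{x}_i^\dagger(t)\|\le c^\dagger$ for a constant $c^\dagger>0$ independent of $t$; (B4) for every $R>0$ there is $M_R>0$ such that $|f_{i,t}(x)|\le M_R$ for all $\|x\|\le R$, all $t\ge T_0$ and all $i$; (B5) the partial derivative $\nabla_t F_t(\mathbf{x})$ with respect to $t$ is bounded uniformly in $t\ge T_0$ and $\mathbf{x}\in\mathbb{R}^{Nn}$; (B6) there is a constant $m_0$ such that for all $a_1,b_1>0$ there are $a_2,b_2>0$ with the property that, for every function $x(\cdot)$ with $\|x(t)\|\le a_1\sqrt{t}+b_1$ for all $t>T_0$, one has $\|\nabla f_{i,t}(x(t))\|\le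 a_2t^{m_0}+b_2$ for all $t>T_0$ and all $i$. Let $k_1>0$, $\sigma>0$, $m<-1$ with $m\le-2m_0$, and $b_0\ge 1$ with $b_0>(\frac{-m}{\sigma})^{\frac{1}{1-m}}$, and define $\alpha_t,\beta_t$ for $t\ge T_0$ by $$e^{\beta_t}=(t+b_0)^m,\qquad e^{\alpha_t}=m(t+b_0)^{-1}+\sigma(t+b_0)^{-m}>0,$$ so that $e^{\alpha_t+\beta_t}-\dot\beta_te^{\beta_t}=\sigma$. Let $\mathbf{x}_1,\dots,\mathbf{x}_N:[T_0,\infty)\to\mathbb{R}^n$ solve, for $i=1,\dots,N$, $$\ddot{\mathbf{x}}_i+(2e^{\alpha_t}-\dot\alpha_t)\dot{\mathbf{x}}_i+e^{2\alpha_t+\beta_t}\nabla f_{i,t}(\mathbf{x}_i)+\sum_{j=1}^N a_{ij}k_1e^{2\alpha_t}(\mathbf{x}_i-\mathbf{x}_j)=0.$$ Then there exist positive constants $c_4,\varrho,\varpi$ independent of $T$, and positive constants $a_2,b_2$ as provided by (B6) with $\|\nabla f_{i,t}(\mathbf{x}_i(t))\|\le a_2t^{m_0}+b_2$ for all $i$ and $t>T_0$, such that for all $T>T_0$: $F_t(\mathbf{y})-F_t(1_N\otimes\tilde x(T))\ge-\varrho$ for all $\mathbf{y}\in\mathbb{R}^{Nn}$ and $t\in[T_0,T]$; $\int_{T_0}^T\bigl(e^{\alpha_t}\mathbf{x}^T(t)\tilde L\mathbf{x}(t)-\frac{\sigma\varrho}{k_1}\bigr)dt\le\frac{\varpi}{k_1}$;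 and $$\mathcal{R}_{d,dis}(T)\le c_4(T-T_0)+\frac{\varpi}{\sigma}+\frac{Na_2}{\sqrt{\sigma}}\sqrt{\frac{N}{w_{\min}}\epsilon_1(T)}+Nb_2\sqrt{\frac{N}{w_{\min}}\epsilon_2(T)},$$ where $$\epsilon_1(T)=\frac{\sigma\varrho}{k_1}(T-T_0)+\frac{\varpi}{k_1},\qquad \epsilon_2(T)=\frac{\varrho}{k_1b_0^{-m}}(T-T_0)+\frac{\varpi}{k_1\sigma b_0^{-m}}.$$
   Context: $T_0\ge0$ is the initial time. Each local cost $(t,x)\mapsto f_{i,t}(x)\in\mathbb{R}$, $t\ge T_0$, $x\in\mathbb{R}^n$, $i=1,\dots,N$, is continuously differentiable, convex in $x$ for every $t$, and smooth in $t$; for every $t$, $f_t$ and each $f_{i,t}$ have at least one minimizer. $\nabla$ is the gradient in the space variable, $\nabla_t$ the partial derivative in $t$, dots are time derivatives, and $\|\cdot\|$ is the Euclidean norm. $\mathcal{G}$ is an undirected connected graph on $\{1,\dots,N\}$ with symmetric adjacency matrix $[a_{ij}]$, $a_{ij}>0$ if $(j,i)$ is an edge, $a_{ij}=0$ otherwise, $a_{ii}=0$; $w_{\min}>0$ is the minimal (positive) edge weight. $L=D-A$ is its Laplacian with $D=\mathrm{diag}\{\sum_j a_{ij}\}$, and $\tilde L=L\otimes I_n$. $1_N$ is the all-ones column vector, and $\mathbf{x}(t)=[\mathbf{x}_1(t)^T,\dots,\mathbf{x}_N(t)^T]^T$. The distributed dynamic regret is $$\mathcal{R}_{d,dis}(T)=\int_{T_0}^T\Bigl(\frac1N\sum_{j=1}^N\sum_{i=1}^N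 f_{i,t}(\mathbf{x}_j(t))-F_t(1_N\otimes x_t^* )\Bigr)dt .$$ *)

theory Defs
  imports "HOL-Analysis.Analysis"
begin

definition grad :: "('a::real_inner \<Rightarrow> real) \<Rightarrow> 'a \<Rightarrow> 'a" where
  "grad g y = (THE v. GDERIV g y :> v)"

(* Derivative in time on [T0, \<infinity>); it is one-sided at the initial time. *)
definition time_deriv :: "real \<Rightarrow> (real \<Rightarrow> 'a::real_normed_vector) \<Rightarrow> real \<Rightarrow> 'a" where
  "time_deriv T0 g t = vector_derivative g (at t within {T0..})"

definition C1_on :: "('a::real_normed_vector \<Rightarrow> 'b::real_normed_vector) \<Rightarrow> 'a set \<Rightarrow> bool" where
  "C1_on g S \<longleftrightarrow> (\<exists>D. continuous_on S D \<and>
     (\<forall>z\<in>S. (g has_derivative blinfun_apply (D z)) (at z within S)))"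

definition smooth_on :: "(real \<Rightarrow> real) \<Rightarrow> real set \<Rightarrow> bool" where
  "smooth_on g S \<longleftrightarrow> (\<exists>D :: nat \<Rightarrow> real \<Rightarrow> real. D 0 = g \<and>
     (\<forall>k. \<forall>t\<in>S. (D k has_real_derivative D (Suc k) t) (at t within S)))"

(* f i t y is the cost of agent i at time t and point y; only times t \<ge> T0 matter. *)
definition admissible_costs :: "real \<Rightarrow> ('v \<Rightarrow> real \<Rightarrow> real ^ 'n \<Rightarrow> real) \<Rightarrow> bool" where
  "admissible_costs T0 f \<longleftrightarrow> (\<forall>i.
     C1_on (\<lambda>(t, y). f i t y) ({T0..} \<times> UNIV) \<and>
     (\<forall>t\<ge>T0. convex_on UNIV (f i t)) \<and>
     (\<forall>y. smooth_on (\<lambda>t. f i t y) {T0..}))"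

(* E is the edge relation on the vertex type 'v; symmetry and absence of loops of E
   follow from those of A. *)
definition connected_weighted_graph :: "('v \<times> 'v) set \<Rightarrow> real ^ 'v ^ 'v \<Rightarrow> bool" where
  "connected_weighted_graph E A \<longleftrightarrow>
     (\<forall>i j. A $ i $ j = A $ j $ i) \<and>
     (\<forall>i. A $ i $ i = 0) \<and>
     (\<forall>i j. if (j, i) \<in> E then A $ i $ j > 0 else A $ i $ j = 0) \<and>
     (\<forall>i j. (i, j) \<in> E\<^sup>*)"

definition edge_weights :: "real ^ 'v ^ 'v \<Rightarrow> real set" where
  "edge_weights A = {A $ i $ j | i j. A $ i $ j > 0}"

definition laplacian :: "real ^ 'v ^ 'v \<Rightarrow> real ^ 'v ^ 'v" where
  "laplacian A = (\<chi> i j. if i = j then \<Sum>k\<in>UNIV. A $ i $ k else 0) - A"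

definition kronecker ::
  "real ^ 'v ^ 'v \<Rightarrow> real ^ 'n ^ 'n \<Rightarrow> real ^ ('v \<times> 'n) ^ ('v \<times> 'n)" where
  "kronecker A B = (\<chi> p q. A $ fst p $ fst q * B $ snd p $ snd q)"

(* R^{Nn} is the type of vectors indexed by pairs (agent, coordinate). *)
definition stack :: "('v::finite \<Rightarrow> real ^ 'n) \<Rightarrow> real ^ ('v \<times> 'n)" where
  "stack y = (\<chi> p. y (fst p) $ snd p)"

definition block :: "real ^ ('v::finite \<times> 'n::finite) \<Rightarrow> 'v \<Rightarrow> real ^ 'n" where
  "block Y i = (\<chi> k. Y $ (i, k))"

definition global_cost ::
  "('v::finite \<Rightarrow> real \<Rightarrow> real ^ 'n \<Rightarrow> real) \<Rightarrow> real \<Rightarrow> real ^ 'n \<Rightarrow> real" where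
  "global_cost f t y = (\<Sum>i\<in>UNIV. f i t y)"

definition stacked_cost ::
  "('v::finite \<Rightarrow> real \<Rightarrow> real ^ 'n \<Rightarrow> real) \<Rightarrow> real \<Rightarrow> real ^ ('v \<times> 'n) \<Rightarrow> real" where
  "stacked_cost f t Y = (\<Sum>i\<in>UNIV. f i t (block Y i))"

definition ones_kron :: "real ^ 'n \<Rightarrow> real ^ ('v::finite \<times> 'n)" where
  "ones_kron y = stack (\<lambda>_. y)"

abbreviation is_minimizer :: "('a \<Rightarrow> real) \<Rightarrow> 'a \<Rightarrow> bool" where
  "is_minimizer g y \<equiv> is_arg_min g (\<lambda>_. True) y"

definition grad_growth ::
  "real \<Rightarrow> ('v \<Rightarrow> real \<Rightarrow> real ^ 'n \<Rightarrow> real) \<Rightarrow> real \<Rightarrow> real \<Rightarrow> real \<Rightarrow> real \<Rightarrow> real \<Rightarrow> bool" where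
  "grad_growth T0 f m0 a1 b1 a2 b2 \<longleftrightarrow>
     (\<forall>y :: real \<Rightarrow> real ^ 'n. (\<forall>t>T0. norm (y t) \<le> a1 * sqrt t + b1) \<longrightarrow>
        (\<forall>i. \<forall>t>T0. norm (grad (f i t) (y t)) \<le> a2 * t powr m0 + b2))"

definition solves_dynamics ::
  "real \<Rightarrow> (real \<Rightarrow> real) \<Rightarrow> (real \<Rightarrow> real) \<Rightarrow> real \<Rightarrow> real ^ 'v ^ 'v \<Rightarrow>
   ('v::finite \<Rightarrow> real \<Rightarrow> real ^ 'n \<Rightarrow> real) \<Rightarrow> ('v \<Rightarrow> real \<Rightarrow> real ^ 'n) \<Rightarrow> bool" where
  "solves_dynamics T0 \<alpha> \<beta> k1 A f x \<longleftrightarrow> (\<exists>v w. \<forall>i. \<forall>t\<ge>T0.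
     (x i has_vector_derivative v i t) (at t within {T0..}) \<and>
     (v i has_vector_derivative w i t) (at t within {T0..}) \<and>
     w i t + (2 * exp (\<alpha> t) - time_deriv T0 \<alpha> t) *\<^sub>R v i t
       + exp (2 * \<alpha> t + \<beta> t) *\<^sub>R grad (f i t) (x i t)
       + (\<Sum>j\<in>UNIV. (A $ i $ j * k1 * exp (2 * \<alpha> t)) *\<^sub>R (x i t - x j t)) = 0)"

definition distributed_regret ::
  "real \<Rightarrow> ('v::finite \<Rightarrow> real \<Rightarrow> real ^ 'n \<Rightarrow> real) \<Rightarrow> (real \<Rightarrow> real ^ 'n) \<Rightarrow>
   ('v \<Rightarrow> real \<Rightarrow> real ^ 'n) \<Rightarrow> real \<Rightarrow> real" where
  "distributed_regret T0 f xstar x T =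
     integral {T0..T} (\<lambda>t.
       1 / real CARD('v) * (\<Sum>j\<in>UNIV. \<Sum>i\<in>UNIV. f i t (x j t))
       - stacked_cost f t (ones_kron (xstar t)))"

end

theory Submission
  imports Defs
begin

text \<open>
  Along a trajectory with stacked state \<open>X\<close>, put \<open>\<Phi> = F\<^sub>t(X) - F\<^sub>t(0)\<close> and let
  \<open>q = exp (\<alpha> t) * (X \<bullet> L X)\<close> be the weighted disagreement. The damping
  \<open>2 exp \<alpha> - \<alpha>'\<close> makes the derivative of \<open>2 X + exp (- \<alpha>) X'\<close> equal to \<open>- exp (\<alpha> + \<beta>) \<nabla>F - k1 exp \<alpha> L X\<close>, so that, by convexity and
  \<open>exp (\<alpha> + \<beta>) - \<beta>' exp \<beta> = \<sigma>\<close>, the function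
  \<open>exp \<beta> * \<Phi> + |X + exp (- \<alpha>) X'|\<^sup>2 / 2 + |X|\<^sup>2 / 2 + k1 / 2 * (X \<bullet> L X)\<close>
  has derivative at most \<open>- \<sigma> \<Phi> - k1 q + 2 C exp \<beta>\<close>, where \<open>C\<close> bounds the time derivative
  of \<open>F\<close> and \<open>exp \<beta>\<close> is integrable. As \<open>\<Phi> \<ge> - \<rho>\<close>, this bounds \<open>\<integral> \<Phi>\<close> from above, \<open>\<integral> q\<close>
  linearly in \<open>T\<close>, and \<open>|X|\<close> by a multiple of \<open>sqrt t\<close> plus a constant. The regret exceeds
  \<open>\<integral> \<Phi>\<close> by at most a linear term and terms \<open>G |x\<^sub>i - x\<^sub>j|\<close>
  with \<open>G = a2 t powr m0 + b2\<close>. Since \<open>m \<le> - 2 m0\<close>, \<open>G\<^sup>2 \<le> H exp \<alpha>\<close> for a constant \<open>H\<close>, and Young's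
  inequality gives \<open>G |x\<^sub>i - x\<^sub>j| \<le> H / 2 + K q\<close>: a linear bound that \<open>c4\<close> and \<open>\<omega>\<close> absorb.
\<close>

section \<open>Gradients and one-sided time derivatives\<close>

lemma GDERIV_unique:
  assumes "GDERIV g y :> a" "GDERIV g y :> b"
  shows "a = b"
proof -
  have "(\<lambda>h. h \<bullet> a) = (\<lambda>h. h \<bullet> b)"
    using assms unfolding gderiv_def by (rule has_derivative_unique)
  then show ?thesis
    by (metis vector_eq_ldot)
qed

lemma grad_eq:
  assumes "GDERIV g y :> a"
  shows "grad g y = a"
  unfolding grad_def using assms GDERIV_unique[OF _ assms] by (rule the_equality)

text \<open>Restricting \<open>g\<close> to the line through \<open>y\<close> and \<open>z\<close>
  reduces the claim to the tangent inequality in one variable.\<close>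

lemma convex_on_GDERIV_above_tangent:
  assumes convex: "convex_on UNIV g" and deriv: "GDERIV g y :> d"
  shows "g z - g y \<ge> d \<bullet> (z - y)"
proof -
  define h where "h s = g (y + s *\<^sub>R (z - y))" for s :: real
  have conv: "convex_on UNIV h"
  proof (rule convex_onI)
    fix s a b :: real
    assume s: "0 < s" "s < 1"
    have "y + ((1 - s) *\<^sub>R a + s *\<^sub>R b) *\<^sub>R (z - y)
        = (1 - s) *\<^sub>R (y + a *\<^sub>R (z - y)) + s *\<^sub>R (y + b *\<^sub>R (z - y))"
      by (simp add: algebra_simps)
    then show "h ((1 - s) *\<^sub>R a + s *\<^sub>R b) \<le> (1 - s) * h a + s * h b"
      unfolding h_def using convex_onD[OF convex, of s] s by simp
  qed simp
  have line: "((\<lambda>s::real. y + s *\<^sub>R (z - y)) has_derivative (\<lambda>s. s *\<^sub>R (z - y))) (at 0)"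
    by (auto intro!: derivative_eq_intros)
  have "(g has_derivative (\<lambda>k. k \<bullet> d)) (at (y + 0 *\<^sub>R (z - y)))"
    using deriv unfolding gderiv_def by simp
  from has_derivative_compose[OF line this]
  have "(h has_derivative (\<lambda>s. (s *\<^sub>R (z - y)) \<bullet> d)) (at 0)"
    unfolding h_def .
  moreover have "(\<lambda>s. (s *\<^sub>R (z - y)) \<bullet> d) = (*) (d \<bullet> (z - y))"
    by (simp add: fun_eq_iff inner_commute)
  ultimately have "(h has_real_derivative d \<bullet> (z - y)) (at 0 within UNIV)"
    unfolding has_field_derivative_def by simp
  from convex_on_imp_above_tangent[OF conv _ _ _ this, of 1]
  show ?thesis by (simp add: h_def)
qed

text \<open>The half-line gives a nontrivial filter even at \<open>t = T0\<close>, since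
  \<open>at_right t\<close> is finer and nontrivial; so the one-sided derivative there is unique
  too.\<close>

lemma time_deriv_eq:
  assumes "t \<ge> T0" "(g has_vector_derivative d) (at t within {T0..})"
  shows "time_deriv T0 g t = d"
proof -
  have "at_right t \<le> at t within {T0..}"
    using assms(1) by (intro at_le) auto
  then have "at t within {T0..} \<noteq> bot"
    using trivial_limit_at_right_real[of t] by (metis bot.extremum_uniqueI)
  then show ?thesis
    unfolding time_deriv_def using assms(2) by (rule vector_derivative_within)
qed

text \<open>The joint derivative \<open>D\<close> determines both partial ones: direction
  \<open>(1, 0)\<close> gives time, \<open>(0, h)\<close> gives space, with the adjoint at 1
  representing that functional as a gradient. Splitting the direction \<open>(1, v)\<close>
  accordingly is the chain rule.\<close>

lemma C1_on_time_space_derivatives: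
  fixes g :: "real \<Rightarrow> 'a::euclidean_space \<Rightarrow> real"
  assumes C1: "C1_on (\<lambda>(t, y). g t y) ({T0..} \<times> UNIV)" and t: "t \<ge> T0"
  shows C1_on_time_deriv:
      "((\<lambda>s. g s y) has_real_derivative time_deriv T0 (\<lambda>s. g s y) t) (at t within {T0..})"
    and C1_on_GDERIV_grad: "GDERIV (g t) y :> grad (g t) y"
    and C1_on_chain_rule: "(x has_vector_derivative v) (at t within {T0..}) \<Longrightarrow>
       ((\<lambda>s. g s (x s)) has_real_derivative
         time_deriv T0 (\<lambda>s. g s (x t)) t + grad (g t) (x t) \<bullet> v) (at t within {T0..})"
proof -
  obtain D where D: "((\<lambda>(t, y). g t y) has_derivative blinfun_apply (D z)) (at z within {T0..} \<times> UNIV)"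
    if "z \<in> {T0..} \<times> UNIV" for z
    using C1 unfolding C1_on_def by blast
  have G: "GDERIV (g t) y :> adjoint (\<lambda>h. D (t, y) (0, h)) 1" for y
  proof -
    have "((\<lambda>y. (\<lambda>(t, y). g t y) (t, y)) has_derivative (\<lambda>h. D (t, y) (0, h))) (at y within UNIV)"
      by (rule has_derivative_in_compose2[OF D]) (use t in \<open>auto intro!: derivative_eq_intros\<close>)
    moreover have "linear (\<lambda>h. D (t, y) (0, h))"
      by (intro bounded_linear.linear bounded_linear_compose[OF blinfun.bounded_linear_right]
          bounded_linear_Pair bounded_linear_zero bounded_linear_ident)
    ultimately show ?thesis
      unfolding gderiv_def by (simp add: adjoint_works)
  qed
  then have gr: "grad (g t) y \<bullet> h = D (t, y) (0, h)" for y h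
  proof -
    have "linear (\<lambda>h. D (t, y) (0, h))"
      by (intro bounded_linear.linear bounded_linear_compose[OF blinfun.bounded_linear_right]
          bounded_linear_Pair bounded_linear_zero bounded_linear_ident)
    then show ?thesis
      using grad_eq[OF G] adjoint_works[of "\<lambda>h. D (t, y) (0, h)" h 1]
      by (simp add: inner_commute)
  qed
  have chain: "((\<lambda>s. g s (x s)) has_real_derivative D (t, x t) (1, 0) + grad (g t) (x t) \<bullet> v)
      (at t within {T0..})"
    if x: "(x has_vector_derivative v) (at t within {T0..})" for x v
  proof -
    have "((\<lambda>s. (\<lambda>(t, y). g t y) (s, x s)) has_derivative (\<lambda>h. D (t, x t) (h, h *\<^sub>R v)))
        (at t within {T0..})"
      by (rule has_derivative_in_compose2[OF D])
        (use t x in \<open>auto simp: has_vector_derivative_def intro!: derivative_eq_intros\<close>)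
    moreover have "D (t, x t) (h, h *\<^sub>R v) = (D (t, x t) (1, 0) + grad (g t) (x t) \<bullet> v) * h" for h
    proof -
      have "(h, h *\<^sub>R v) = h *\<^sub>R ((1, 0) + (0, v))" by simp
      then show ?thesis
        by (simp only: blinfun.scaleR_right blinfun.add_right gr) simp
    qed
    ultimately show ?thesis
      unfolding has_field_derivative_def by simp
  qed
  have time: "((\<lambda>s. g s y) has_real_derivative D (t, y) (1, 0)) (at t within {T0..})" for y
    using chain[OF has_vector_derivative_const[of y]] by simp
  have td: "time_deriv T0 (\<lambda>s. g s y) t = D (t, y) (1, 0)" for y
    by (rule time_deriv_eq[OF t time[unfolded has_real_derivative_iff_has_vector_derivative]])
  show "((\<lambda>s. g s y) has_real_derivative time_deriv T0 (\<lambda>s. g s y) t) (at t within {T0..})"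
    unfolding td by (rule time)
  show "GDERIV (g t) y :> grad (g t) y"
    using G grad_eq by metis
  show "((\<lambda>s. g s (x s)) has_real_derivative
      time_deriv T0 (\<lambda>s. g s (x t)) t + grad (g t) (x t) \<bullet> v) (at t within {T0..})"
    if "(x has_vector_derivative v) (at t within {T0..})"
    unfolding td using that by (rule chain)
qed

section \<open>Graph Laplacian and disagreement\<close>

text \<open>Swapping the indices flips the sign of \<open>u i - u j\<close>, so subtracting the
  \<open>v j\<close> part doubles the \<open>v i\<close> part. With \<open>v = u\<close> this writes
  the Laplacian form as a sum over edges; with \<open>v\<close> the velocities it serves to
  differentiate that form.\<close>

lemma sum_weighted_diff_inner:
  fixes a :: "'v::finite \<Rightarrow> 'v \<Rightarrow> real" and u v :: "'v \<Rightarrow> 'a::real_inner"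
  assumes sym: "\<And>i j. a i j = a j i"
  shows "(\<Sum>i\<in>UNIV. \<Sum>j\<in>UNIV. a i j * ((u i - u j) \<bullet> (v i - v j)))
    = 2 * (\<Sum>i\<in>UNIV. v i \<bullet> (\<Sum>j\<in>UNIV. a i j *\<^sub>R (u i - u j)))"
proof -
  have "(\<Sum>i\<in>UNIV. \<Sum>j\<in>UNIV. a i j * ((u i - u j) \<bullet> v j))
      = (\<Sum>j\<in>UNIV. \<Sum>i\<in>UNIV. a i j * ((u i - u j) \<bullet> v j))"
    by (rule sum.swap)
  also have "\<dots> = - (\<Sum>i\<in>UNIV. \<Sum>j\<in>UNIV. a i j * ((u i - u j) \<bullet> v i))"
    by (simp add: sum_negf[symmetric] sym inner_diff_left algebra_simps)
  finally show ?thesis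
    by (simp add: inner_diff_right right_diff_distrib sum_subtractf inner_sum_right
        inner_commute)
qed

text \<open>The identity factor couples equal coordinates only, so the stacked matrix acts blockwise
  and matches the neighbour sums in the dynamics.\<close>

lemma stack_laplacian_stack:
  fixes A :: "real ^ 'v ^ 'v" and y :: "'v::finite \<Rightarrow> real ^ 'n::finite"
  shows "stack y \<bullet> (kronecker (laplacian A) (mat 1) *v stack y)
    = (\<Sum>i\<in>UNIV. y i \<bullet> (\<Sum>j\<in>UNIV. A $ i $ j *\<^sub>R (y i - y j)))"
proof -
  have pair: "(\<Sum>p\<in>UNIV. h p) = (\<Sum>i\<in>UNIV. \<Sum>k\<in>UNIV. h (i, k))" for h :: "'v \<times> 'n \<Rightarrow> real"
    by (simp add: sum.cartesian_product UNIV_Times_UNIV)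
  have "(kronecker (laplacian A) (mat 1) *v stack y) $ (i, k)
      = (\<Sum>j\<in>UNIV. A $ i $ j *\<^sub>R (y i - y j)) $ k" for i k
  proof -
    have "(kronecker (laplacian A) (mat 1) *v stack y) $ (i, k)
        = (\<Sum>j\<in>UNIV. \<Sum>l\<in>UNIV. laplacian A $ i $ j * (if k = l then 1 else 0) * y j $ l)"
      by (simp add: matrix_vector_mult_def kronecker_def stack_def pair mat_def)
    also have "\<dots> = (\<Sum>j\<in>UNIV. laplacian A $ i $ j * y j $ k)"
      by (simp add: if_distrib if_distribR cong: if_cong)
    also have "\<dots> = (\<Sum>j\<in>UNIV. (if i = j then (\<Sum>l\<in>UNIV. A $ i $ l) * y j $ k else 0)
        - A $ i $ j * y j $ k)"
      by (rule sum.cong) (auto simp: laplacian_def algebra_simps)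
    also have "\<dots> = (\<Sum>j\<in>UNIV. A $ i $ j *\<^sub>R (y i - y j)) $ k"
      by (simp add: sum_subtractf sum_distrib_right right_diff_distrib)
    finally show ?thesis .
  qed
  then show ?thesis
    by (simp add: inner_vec_def[where 'b = "'v \<times> 'n"] inner_vec_def pair stack_def)
qed

text \<open>Induction along a path: appending an edge doubles the constant and adds
  \<open>2 / A $ j $ l\<close>, as one edge term is at most the whole sum. Summing over the finitely
  many pairs makes the constant uniform; it takes the place of a spectral gap.\<close>

lemma connected_disagreement_bound:
  fixes A :: "real ^ 'v ^ 'v::finite"
  assumes graph: "connected_weighted_graph E A"
  shows "\<exists>K\<ge>0. \<forall>(y :: 'v \<Rightarrow> 'a::real_inner) i j.
    (norm (y i - y j))\<^sup>2 \<le> K * (\<Sum>k\<in>UNIV. \<Sum>l\<in>UNIV. A $ k $ l * (norm (y k - y l))\<^sup>2)"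
proof -
  let ?Q = "\<lambda>y :: 'v \<Rightarrow> 'a. \<Sum>k\<in>UNIV. \<Sum>l\<in>UNIV. A $ k $ l * (norm (y k - y l))\<^sup>2"
  have nonneg: "A $ i $ j \<ge> 0" for i j
    using graph unfolding connected_weighted_graph_def by (metis less_eq_real_def)
  have edge: "A $ i $ j * (norm (y i - y j))\<^sup>2 \<le> ?Q y" for y i j
  proof -
    have "A $ i $ j * (norm (y i - y j))\<^sup>2 \<le> (\<Sum>l\<in>UNIV. A $ i $ l * (norm (y i - y l))\<^sup>2)"
      by (rule member_le_sum) (auto simp: nonneg)
    also have "\<dots> \<le> ?Q y"
      by (rule member_le_sum[of i]) (auto simp: nonneg sum_nonneg)
    finally show ?thesis .
  qed
  have Q: "?Q y \<ge> 0" for y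
    by (intro sum_nonneg) (simp add: nonneg)
  have "\<exists>K\<ge>0. \<forall>y. (norm (y i - y j))\<^sup>2 \<le> K * ?Q y" if "(i, j) \<in> E\<^sup>*" for i j
    using that
  proof (induction rule: rtrancl_induct)
    case base
    then show ?case by (intro exI[of _ 0]) simp
  next
    case (step j l)
    then obtain K where K: "K \<ge> 0" "\<And>y. (norm (y i - y j))\<^sup>2 \<le> K * ?Q y"
      by blast
    have pos: "A $ l $ j > 0" and sym: "A $ l $ j = A $ j $ l"
      using graph step(2) unfolding connected_weighted_graph_def by metis+
    have "(norm (y i - y l))\<^sup>2 \<le> (2 * K + 2 / A $ j $ l) * ?Q y" for y
    proof -
      have "norm (y i - y l) \<le> norm (y i - y j) + norm (y j - y l)"
        using norm_triangle_ineq[of "y i - y j" "y j - y l"] by simp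
      then have "(norm (y i - y l))\<^sup>2 \<le> (norm (y i - y j) + norm (y j - y l))\<^sup>2"
        by (simp add: power_mono)
      also have "\<dots> \<le> 2 * (norm (y i - y j))\<^sup>2 + 2 * (norm (y j - y l))\<^sup>2"
        using sum_squares_bound[of "norm (y i - y j)" "norm (y j - y l)"]
        by (simp add: power2_sum)
      also have "(norm (y j - y l))\<^sup>2 \<le> ?Q y / A $ j $ l"
        using edge[of j l y] pos sym by (simp add: field_simps)
      also have "2 * (norm (y i - y j))\<^sup>2 + 2 * (?Q y / A $ j $ l)
          \<le> 2 * (K * ?Q y) + 2 * (?Q y / A $ j $ l)"
        using K(2)[of y] by simp
      finally show ?thesis by (simp add: algebra_simps)
    qed
    then show ?case
      using K(1) pos sym by (intro exI[of _ "2 * K + 2 / A $ j $ l"]) auto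
  qed
  then have pair: "\<exists>K. K \<ge> 0 \<and> (\<forall>y. (norm (y i - y j))\<^sup>2 \<le> K * ?Q y)" for i j
    using graph unfolding connected_weighted_graph_def by blast
  define K where "K i j = (SOME K. K \<ge> 0 \<and> (\<forall>y. (norm (y i - y j))\<^sup>2 \<le> K * ?Q y))" for i j
  have K: "K i j \<ge> 0" "(norm (y i - y j))\<^sup>2 \<le> K i j * ?Q y" for i j y
    using someI_ex[OF pair[of i j]] unfolding K_def by blast+
  show ?thesis
  proof (intro exI[of _ "\<Sum>i\<in>UNIV. \<Sum>j\<in>UNIV. K i j"] conjI allI)
    fix y :: "'v \<Rightarrow> 'a" and i j
    have "K i j \<le> (\<Sum>j\<in>UNIV. K i j)"
      by (rule member_le_sum) (auto simp: K)
    also have "\<dots> \<le> (\<Sum>i\<in>UNIV. \<Sum>j\<in>UNIV. K i j)"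
      by (rule member_le_sum[of i]) (auto simp: K sum_nonneg)
    finally show "(norm (y i - y j))\<^sup>2 \<le> (\<Sum>i\<in>UNIV. \<Sum>j\<in>UNIV. K i j) * ?Q y"
      using K(2)[of y i j] Q[of y] by (meson mult_right_mono order_trans)
  qed (simp add: K sum_nonneg)
qed

section \<open>The time-dependent coefficient \<open>exp \<alpha>\<close>\<close>

text \<open>Raised to the power \<open>1 - m\<close>, the lower bound on \<open>b0\<close> says
  exactly that \<open>\<sigma> + m / b0 powr (1 - m)\<close> is positive. Relative to
  \<open>s powr (-m)\<close>, the negative term \<open>m / s\<close> is worst at
  \<open>s = b0\<close>.\<close>

lemma scaling_lower_bound:
  fixes m \<sigma> b0 s :: real
  assumes "\<sigma> > 0" "m < -1" "b0 \<ge> 1" "b0 > (-m / \<sigma>) powr (1 / (1 - m))" "s \<ge> b0"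
  shows "\<sigma> + m / b0 powr (1 - m) > 0"
    and "m * inverse s + \<sigma> * s powr (-m) \<ge> (\<sigma> + m / b0 powr (1 - m)) * s powr (-m)"
proof -
  have "-m / \<sigma> = ((-m / \<sigma>) powr (1 / (1 - m))) powr (1 - m)"
    using assms by (simp add: powr_powr)
  also have "\<dots> < b0 powr (1 - m)"
    using assms by (intro powr_less_mono2) auto
  finally show "\<sigma> + m / b0 powr (1 - m) > 0"
    using assms by (simp add: field_simps)
  have "s powr (-m) * s = s powr (1 - m)"
    using assms powr_mult_base[of s "-m"] by (simp add: mult.commute)
  moreover have "b0 powr (1 - m) \<le> s powr (1 - m)"
    using assms by (intro powr_mono2) auto
  ultimately have "b0 powr (1 - m) \<le> s powr (-m) * s" by simp
  then have "1 / s \<le> s powr (-m) / b0 powr (1 - m)"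
    using assms by (simp add: field_simps)
  then have "m * (1 / s) \<ge> m * (s powr (-m) / b0 powr (1 - m))"
    using assms by (intro mult_left_mono_neg) auto
  then show "m * inverse s + \<sigma> * s powr (-m) \<ge> (\<sigma> + m / b0 powr (1 - m)) * s powr (-m)"
    by (simp add: field_simps)
qed

section \<open>Lyapunov function along a trajectory\<close>

lemma block_stack [simp]: "block (stack y) i = y i"
  by (simp add: block_def stack_def vec_eq_iff)

text \<open>The equation turns the derivative of \<open>x + exp (- \<alpha>) v\<close> into
  \<open>- v - exp (\<alpha> + b) g - k exp \<alpha> l\<close>: the acceleration and
  \<open>a\<close> drop out. The product of \<open>x\<close> and \<open>v\<close> then cancels
  against the derivative of \<open>|x|^2 / 2\<close>.\<close>

lemma agent_energy_derivative:
  fixes x v :: "real \<Rightarrow> 'a::real_inner"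
  assumes x: "(x has_vector_derivative v t) (at t within S)"
    and v: "(v has_vector_derivative w) (at t within S)"
    and \<alpha>: "(\<alpha> has_real_derivative a) (at t within S)"
    and ode: "w + (2 * exp (\<alpha> t) - a) *\<^sub>R v t + exp (2 * \<alpha> t + b) *\<^sub>R g
      + (k * exp (2 * \<alpha> t)) *\<^sub>R l = 0"
  shows "((\<lambda>s. ((x s + exp (- \<alpha> s) *\<^sub>R v s) \<bullet> (x s + exp (- \<alpha> s) *\<^sub>R v s) + x s \<bullet> x s) / 2)
    has_real_derivative
      - exp (- \<alpha> t) * (v t \<bullet> v t) - exp (\<alpha> t) * exp b * (x t \<bullet> g) - exp b * (v t \<bullet> g)
      - k * exp (\<alpha> t) * (x t \<bullet> l) - k * (v t \<bullet> l)) (at t within S)"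
proof -
  define e where "e = exp (\<alpha> t)"
  have e: "e > 0" "exp (- \<alpha> t) = 1 / e" "exp (2 * \<alpha> t) = e * e" "exp (2 * \<alpha> t + b) = e * e * exp b"
    unfolding e_def by (simp_all add: exp_minus divide_inverse mult_exp_exp)
  have p: "((\<lambda>s. x s + exp (- \<alpha> s) *\<^sub>R v s) has_vector_derivative
      v t + (exp (- \<alpha> t) *\<^sub>R w + (exp (- \<alpha> t) * (- a)) *\<^sub>R v t)) (at t within S)"
    by (intro has_vector_derivative_add x has_vector_derivative_scaleR v)
      (auto intro!: derivative_eq_intros \<alpha>)
  have w: "w = - ((2 * e - a) *\<^sub>R v t + (e * e * exp b) *\<^sub>R g + (k * (e * e)) *\<^sub>R l)"
    using ode unfolding e(3,4) e_def[symmetric] eq_neg_iff_add_eq_0 by (simp only: add.assoc)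
  have p': "v t + (exp (- \<alpha> t) *\<^sub>R w + (exp (- \<alpha> t) * (- a)) *\<^sub>R v t)
      = - v t - (e * exp b) *\<^sub>R g - (k * e) *\<^sub>R l"
  proof -
    have c: "1 / e * (2 * e - a) = 2 - a / e" "1 / e * (e * e * exp b) = e * exp b"
      "1 / e * (k * (e * e)) = k * e" "1 / e * (- a) = - (a / e)"
      using e(1) by (simp_all add: field_simps)
    show ?thesis
      unfolding w e(2) scaleR_minus_right scaleR_add_right scaleR_scaleR c
      by (simp add: scaleR_diff_left scaleR_2)
  qed
  have dot: "((\<lambda>s. y s \<bullet> y s) has_real_derivative 2 * (y t \<bullet> d)) (at t within S)"
    if "(y has_vector_derivative d) (at t within S)" for y :: "real \<Rightarrow> 'a" and d
    using has_derivative_inner[OF that[unfolded has_vector_derivative_def]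
        that[unfolded has_vector_derivative_def]]
    unfolding has_field_derivative_def
    by (rule has_derivative_eq_rhs) (simp add: fun_eq_iff inner_commute)
  show ?thesis
    by (rule DERIV_cong[OF DERIV_cdivide[OF DERIV_add[OF dot[OF p] dot[OF x]]]],
        unfold p', unfold e(2) e_def[symmetric])
      (use e(1) in \<open>simp add: inner_simps field_simps inner_commute\<close>)
qed

text \<open>The term with \<open>(t + b0) powr (m + 1)\<close> in \<open>U\<close> below has derivative
  \<open>- 2 * C * exp (\<beta> t)\<close> and so absorbs the explicit time dependence of the costs.\<close>

lemma lyapunov_dissipation:
  fixes f :: "'v::finite \<Rightarrow> real \<Rightarrow> real ^ 'n::finite \<Rightarrow> real"
  assumes T0: "T0 \<ge> 0" and costs: "admissible_costs T0 f"
    and sym: "\<And>i j. A $ i $ j = A $ j $ i"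
    and time: "\<And>t Y. t \<ge> T0 \<Longrightarrow> \<bar>time_deriv T0 (\<lambda>s. stacked_cost f s Y) t\<bar> \<le> C"
    and m: "m < -1" and b0: "b0 \<ge> 1"
    and beta: "\<And>t. t \<ge> T0 \<Longrightarrow> exp (\<beta> t) = (t + b0) powr m"
    and alpha: "\<And>t. t \<ge> T0 \<Longrightarrow>
        exp (\<alpha> t) = m * inverse (t + b0) + \<sigma> * (t + b0) powr (-m)"
    and dynamics: "solves_dynamics T0 \<alpha> \<beta> k1 A f x"
    and k1: "k1 > 0"
    and nonneg: "\<And>i j. A $ i $ j \<ge> 0"
  obtains U dU where
    "\<And>t. t \<ge> T0 \<Longrightarrow> (U has_real_derivative dU t) (at t within {T0..})"
    "\<And>t. t \<ge> T0 \<Longrightarrow> dU t \<le> - \<sigma> * (\<Sum>i\<in>UNIV. f i t (x i t) - f i t 0)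
      - k1 * exp (\<alpha> t) * (\<Sum>i\<in>UNIV. x i t \<bullet> (\<Sum>j\<in>UNIV. A $ i $ j *\<^sub>R (x i t - x j t)))"
    "\<And>t. t \<ge> T0 \<Longrightarrow> U t \<ge> exp (\<beta> t) * (\<Sum>i\<in>UNIV. f i t (x i t) - f i t 0)
      + (\<Sum>i\<in>UNIV. x i t \<bullet> x i t) / 2"
proof -
  obtain v w where
    x: "\<And>i t. t \<ge> T0 \<Longrightarrow> (x i has_vector_derivative v i t) (at t within {T0..})" and
    v: "\<And>i t. t \<ge> T0 \<Longrightarrow> (v i has_vector_derivative w i t) (at t within {T0..})" and
    ode: "\<And>i t. t \<ge> T0 \<Longrightarrow> w i t + (2 * exp (\<alpha> t) - time_deriv T0 \<alpha> t) *\<^sub>R v i t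
       + exp (2 * \<alpha> t + \<beta> t) *\<^sub>R grad (f i t) (x i t)
       + (\<Sum>j\<in>UNIV. (A $ i $ j * k1 * exp (2 * \<alpha> t)) *\<^sub>R (x i t - x j t)) = 0"
    using dynamics unfolding solves_dynamics_def by blast
  have C1: "C1_on (\<lambda>(t, y). f i t y) ({T0..} \<times> UNIV)" for i
    using costs unfolding admissible_costs_def by blast
  note gr = C1_on_GDERIV_grad[OF C1]
  define ft where "ft i t y = time_deriv T0 (\<lambda>s. f i s y) t" for i t y
  note ft = C1_on_time_deriv[OF C1, folded ft_def]
  note chain = C1_on_chain_rule[OF C1, folded ft_def]
  \<comment> \<open>Only the derivative of the summed cost is bounded, not each
    \<open>ft i t\<close>; evaluating at \<open>stack y\<close> allows a different point for each
    agent.\<close>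
  have ft_bound: "\<bar>\<Sum>i\<in>UNIV. ft i t (y i)\<bar> \<le> C" if "t \<ge> T0" for t y
  proof -
    have "((\<lambda>s. \<Sum>i\<in>UNIV. f i s (y i)) has_real_derivative (\<Sum>i\<in>UNIV. ft i t (y i))) (at t within {T0..})"
      by (intro DERIV_sum ft that)
    then have "time_deriv T0 (\<lambda>s. stacked_cost f s (stack y)) t = (\<Sum>i\<in>UNIV. ft i t (y i))"
      using that by (intro time_deriv_eq)
        (simp_all add: stacked_cost_def has_real_derivative_iff_has_vector_derivative)
    then show ?thesis using time[OF that, of "stack y"] by simp
  qed
  \<comment> \<open>Only \<open>exp (\<alpha> t)\<close> is prescribed; taking its logarithm shows
    that \<open>time_deriv T0 \<alpha>\<close> is a genuine derivative.\<close>
  have alpha_diff: "(\<alpha> has_real_derivative time_deriv T0 \<alpha> t) (at t within {T0..})" if t: "t \<ge> T0" for t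
  proof -
    let ?e = "\<lambda>t. m * inverse (t + b0) + \<sigma> * (t + b0) powr (-m)"
    have pos: "t + b0 > 0" using t T0 b0 by linarith
    have epos: "?e t > 0" unfolding alpha[OF t, symmetric] by simp
    have "\<exists>d. ((\<lambda>t. ln (?e t)) has_real_derivative d) (at t within {T0..})"
      using pos epos by (auto intro!: exI derivative_eq_intros refl)
    then obtain d where d: "((\<lambda>t. ln (?e t)) has_real_derivative d) (at t within {T0..})"
      by blast
    have "\<alpha> s = ln (?e s)" if "s \<ge> T0" for s
      unfolding alpha[OF that, symmetric] by simp
    then have "(\<alpha> has_real_derivative d) (at t within {T0..})"
      using t by (intro has_field_derivative_transform_within[OF d zero_less_one]) auto
    then show ?thesis
      using time_deriv_eq[OF t] by (metis has_real_derivative_iff_has_vector_derivative)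
  qed
  define l where "l i t = (\<Sum>j\<in>UNIV. A $ i $ j *\<^sub>R (x i t - x j t))" for i t
  define F where "F t = (\<Sum>i\<in>UNIV. f i t (x i t) - f i t 0)" for t
  define Q where "Q t = (\<Sum>i\<in>UNIV. x i t \<bullet> l i t)" for t
  define V where "V t = (\<Sum>i\<in>UNIV. ((x i t + exp (- \<alpha> t) *\<^sub>R v i t) \<bullet> (x i t + exp (- \<alpha> t) *\<^sub>R v i t)
    + x i t \<bullet> x i t) / 2)" for t
  define U where "U t = V t + (t + b0) powr m * F t + k1 / 2 * Q t
    - 2 * C / (m + 1) * (t + b0) powr (m + 1)" for t
  define S1 where "S1 t = (\<Sum>i\<in>UNIV. x i t \<bullet> grad (f i t) (x i t))" for t
  define S2 where "S2 t = (\<Sum>i\<in>UNIV. v i t \<bullet> grad (f i t) (x i t))" for t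
  define S4 where "S4 t = (\<Sum>i\<in>UNIV. v i t \<bullet> l i t)" for t
  define S5 where "S5 t = (\<Sum>i\<in>UNIV. v i t \<bullet> v i t)" for t
  define St where "St t = (\<Sum>i\<in>UNIV. ft i t (x i t)) - (\<Sum>i\<in>UNIV. ft i t 0)" for t
  have dV: "(V has_real_derivative - exp (- \<alpha> t) * S5 t - exp (\<alpha> t) * exp (\<beta> t) * S1 t
      - exp (\<beta> t) * S2 t - k1 * exp (\<alpha> t) * Q t - k1 * S4 t) (at t within {T0..})"
    if t: "t \<ge> T0" for t
  proof -
    have "(\<Sum>j\<in>UNIV. (A $ i $ j * k1 * exp (2 * \<alpha> t)) *\<^sub>R (x i t - x j t))
        = (k1 * exp (2 * \<alpha> t)) *\<^sub>R l i t" for i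
      unfolding l_def by (simp add: scaleR_sum_right mult_ac)
    then have "((\<lambda>t. ((x i t + exp (- \<alpha> t) *\<^sub>R v i t) \<bullet> (x i t + exp (- \<alpha> t) *\<^sub>R v i t)
        + x i t \<bullet> x i t) / 2) has_real_derivative
        - exp (- \<alpha> t) * (v i t \<bullet> v i t) - exp (\<alpha> t) * exp (\<beta> t) * (x i t \<bullet> grad (f i t) (x i t))
        - exp (\<beta> t) * (v i t \<bullet> grad (f i t) (x i t))
        - k1 * exp (\<alpha> t) * (x i t \<bullet> l i t) - k1 * (v i t \<bullet> l i t)) (at t within {T0..})" for i
      using ode[OF t, of i]
      by (intro agent_energy_derivative[OF x[OF t] v[OF t] alpha_diff[OF t]]) simp
    then have "(V has_real_derivative (\<Sum>i\<in>UNIV.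
        - exp (- \<alpha> t) * (v i t \<bullet> v i t) - exp (\<alpha> t) * exp (\<beta> t) * (x i t \<bullet> grad (f i t) (x i t))
        - exp (\<beta> t) * (v i t \<bullet> grad (f i t) (x i t))
        - k1 * exp (\<alpha> t) * (x i t \<bullet> l i t) - k1 * (v i t \<bullet> l i t))) (at t within {T0..})"
      unfolding V_def by (intro DERIV_sum)
    then show ?thesis
      unfolding Q_def S1_def S2_def S4_def S5_def sum_distrib_left sum_subtractf .
  qed
  have dF: "(F has_real_derivative St t + S2 t) (at t within {T0..})" if t: "t \<ge> T0" for t
  proof -
    have "(F has_real_derivative
        (\<Sum>i\<in>UNIV. ft i t (x i t) + grad (f i t) (x i t) \<bullet> v i t - ft i t 0)) (at t within {T0..})"
      unfolding F_def by (intro DERIV_sum DERIV_diff chain t x ft)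
    then show ?thesis
      unfolding St_def S2_def by (simp add: sum.distrib sum_subtractf inner_commute algebra_simps)
  qed
  have Q_eq: "Q t = (\<Sum>i\<in>UNIV. \<Sum>j\<in>UNIV. A $ i $ j * ((x i t - x j t) \<bullet> (x i t - x j t))) / 2" for t
    using sum_weighted_diff_inner[of "\<lambda>i j. A $ i $ j" "\<lambda>i. x i t" "\<lambda>i. x i t", OF sym]
    unfolding Q_def l_def by simp
  have dQ: "(Q has_real_derivative 2 * S4 t) (at t within {T0..})" if t: "t \<ge> T0" for t
  proof -
    have d: "((\<lambda>s. (x i s - x j s) \<bullet> (x i s - x j s)) has_real_derivative
        2 * ((x i t - x j t) \<bullet> (v i t - v j t))) (at t within {T0..})" for i j
    proof -
      note d = has_vector_derivative_diff[OF x[OF t, of i] x[OF t, of j], unfolded has_vector_derivative_def]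
      show ?thesis
        using has_derivative_inner[OF d d] unfolding has_field_derivative_def
        by (rule has_derivative_eq_rhs) (simp add: fun_eq_iff inner_commute)
    qed
    have "((\<lambda>s. (\<Sum>i\<in>UNIV. \<Sum>j\<in>UNIV. A $ i $ j * ((x i s - x j s) \<bullet> (x i s - x j s))) / 2)
        has_real_derivative (\<Sum>i\<in>UNIV. \<Sum>j\<in>UNIV. A $ i $ j * (2 * ((x i t - x j t) \<bullet> (v i t - v j t)))) / 2)
        (at t within {T0..})"
      by (rule DERIV_cdivide, rule DERIV_sum, rule DERIV_sum, rule DERIV_cmult, rule d)
    moreover have "(\<Sum>i\<in>UNIV. \<Sum>j\<in>UNIV. A $ i $ j * (2 * ((x i t - x j t) \<bullet> (v i t - v j t)))) / 2
        = 2 * S4 t"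
      using sum_weighted_diff_inner[of "\<lambda>i j. A $ i $ j" "\<lambda>i. x i t" "\<lambda>i. v i t", OF sym]
      unfolding S4_def l_def by (simp add: mult.left_commute[of "A $ i $ j" 2 for i j] flip: sum_distrib_left)
    ultimately show ?thesis
      unfolding Q_eq[abs_def] by simp
  qed
  \<comment> \<open>The \<open>S2\<close> terms cancel because
    \<open>exp (\<beta> t) = (t + b0) powr m\<close>, the \<open>S4\<close> terms because of the
    weight \<open>k1 / 2\<close> on \<open>Q\<close>.\<close>
  define dU where "dU t = (- exp (- \<alpha> t) * S5 t - exp (\<alpha> t) * exp (\<beta> t) * S1 t
      - exp (\<beta> t) * S2 t - k1 * exp (\<alpha> t) * Q t - k1 * S4 t)
    + (m * (t + b0) powr (m - 1) * F t + (t + b0) powr m * (St t + S2 t))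
    + k1 / 2 * (2 * S4 t) - 2 * C * (t + b0) powr m" for t
  show thesis
  proof (rule that[of U dU])
    fix t assume t: "t \<ge> T0"
    have pos: "t + b0 > 0" using t T0 b0 by linarith
    have dp: "((\<lambda>s. (s + b0) powr r) has_real_derivative r * (t + b0) powr (r - 1)) (at t within {T0..})" for r
      using pos by (auto intro!: derivative_eq_intros)
    show "(U has_real_derivative dU t) (at t within {T0..})"
      unfolding U_def dU_def
      by (rule DERIV_cong[OF DERIV_diff[OF DERIV_add[OF DERIV_add[OF dV[OF t]
            DERIV_mult[OF dp dF[OF t]]] DERIV_cmult[OF dQ[OF t]]] DERIV_cmult[OF dp]]])
        (use m in simp)
    have "f i t (x i t) - f i t 0 \<le> x i t \<bullet> grad (f i t) (x i t)" for i
    proof -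
      have "convex_on UNIV (f i t)" using costs t unfolding admissible_costs_def by blast
      from convex_on_GDERIV_above_tangent[OF this gr[OF t], of "x i t" 0]
      show ?thesis by (simp add: inner_commute)
    qed
    then have "F t \<le> S1 t" unfolding F_def S1_def by (rule sum_mono)
    then have 1: "exp (\<alpha> t) * exp (\<beta> t) * F t \<le> exp (\<alpha> t) * exp (\<beta> t) * S1 t"
      by (intro mult_left_mono) auto
    \<comment> \<open>The powers \<open>-m\<close> and \<open>m\<close> cancel, leaving
      \<open>\<sigma>\<close> plus the derivative of \<open>(t + b0) powr m\<close>, which offsets
      the matching \<open>F\<close> term of \<open>dU\<close>.\<close>
    have "exp (\<alpha> t) * exp (\<beta> t) = m * ((t + b0) powr m / (t + b0)) + \<sigma> * ((t + b0) powr (-m) * (t + b0) powr m)"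
      unfolding alpha[OF t] beta[OF t] by (simp add: field_simps)
    also have "\<dots> = m * (t + b0) powr (m - 1) + \<sigma>"
      using pos by (simp add: powr_minus powr_diff)
    finally have 2: "exp (\<alpha> t) * exp (\<beta> t) = m * (t + b0) powr (m - 1) + \<sigma>" .
    have "\<bar>St t\<bar> \<le> 2 * C"
      using ft_bound[OF t, of "\<lambda>i. x i t"] ft_bound[OF t, of "\<lambda>_. 0"] unfolding St_def by linarith
    then have 3: "exp (\<beta> t) * St t \<le> exp (\<beta> t) * (2 * C)"
      by (intro mult_left_mono) auto
    have 4: "exp (- \<alpha> t) * S5 t \<ge> 0"
      unfolding S5_def by (simp add: sum_nonneg)
    have "dU t \<le> - exp (\<alpha> t) * exp (\<beta> t) * F t + m * (t + b0) powr (m - 1) * F t - k1 * exp (\<alpha> t) * Q t"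
    proof -
      have "dU t = - (exp (- \<alpha> t) * S5 t) - exp (\<alpha> t) * exp (\<beta> t) * S1 t - k1 * exp (\<alpha> t) * Q t
          + m * (t + b0) powr (m - 1) * F t + (exp (\<beta> t) * St t - exp (\<beta> t) * (2 * C))"
        unfolding dU_def beta[OF t, symmetric] by (simp add: algebra_simps)
      then show ?thesis using 1 3 4 by linarith
    qed
    also have "\<dots> = - \<sigma> * F t - k1 * exp (\<alpha> t) * Q t"
      using 2 by (simp add: algebra_simps flip: distrib_left)
    finally show "dU t \<le> - \<sigma> * (\<Sum>i\<in>UNIV. f i t (x i t) - f i t 0)
      - k1 * exp (\<alpha> t) * (\<Sum>i\<in>UNIV. x i t \<bullet> (\<Sum>j\<in>UNIV. A $ i $ j *\<^sub>R (x i t - x j t)))"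
      unfolding F_def Q_def l_def .
    \<comment> \<open>As \<open>m + 1 < 0\<close>, the correction subtracted in \<open>U\<close> is
      nonpositive; dropping it, together with \<open>Q\<close> and the square containing the
      velocity, only lowers \<open>U\<close>.\<close>
    have "C \<ge> 0" using time[of T0 0] by simp
    then have "2 * C / (m + 1) * (t + b0) powr (m + 1) \<le> 0"
      using m by (intro mult_nonpos_nonneg divide_nonneg_neg) auto
    moreover have "Q t \<ge> 0"
      unfolding Q_eq by (intro divide_nonneg_pos sum_nonneg mult_nonneg_nonneg nonneg) auto
    moreover have "V t \<ge> (\<Sum>i\<in>UNIV. x i t \<bullet> x i t) / 2"
      unfolding V_def sum_divide_distrib by (intro sum_mono) auto
    ultimately show "U t \<ge> exp (\<beta> t) * (\<Sum>i\<in>UNIV. f i t (x i t) - f i t 0)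
      + (\<Sum>i\<in>UNIV. x i t \<bullet> x i t) / 2"
      using k1 unfolding U_def F_def[symmetric] beta[OF t]
      by (smt (verit) mult_nonneg_nonneg divide_nonneg_pos)
  qed
qed

section \<open>Growth of gradients and comparison of integrals\<close>

text \<open>Both \<open>t powr m0\<close> and 1 are at most \<open>(t + b0) powr (- m / 2)\<close>:
  for \<open>m0 \<ge> 0\<close> by \<open>m0 \<le> - m / 2\<close>, for negative \<open>m0\<close>
  because \<open>t \<ge> 1\<close>.\<close>

lemma grad_growth_sq_le:
  fixes t :: real
  assumes "t \<ge> 1" "b0 \<ge> 1" "m < -1" "m \<le> -2 * m0" "a > 0" "b > 0"
  shows "(a * t powr m0 + b)\<^sup>2 \<le> (a + b)\<^sup>2 * (t + b0) powr (-m)"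
proof -
  let ?s = "(t + b0) powr (- m / 2)"
  have one: "1 \<le> ?s"
    using assms by (intro ge_one_powr_ge_zero) auto
  have "t powr m0 \<le> ?s"
  proof (cases "m0 \<ge> 0")
    case True
    then have "t powr m0 \<le> (t + b0) powr m0"
      using assms by (intro powr_mono2) auto
    also have "\<dots> \<le> ?s"
      using assms by (intro powr_mono) auto
    finally show ?thesis .
  next
    case False
    then have "t powr m0 \<le> t powr 0"
      using assms by (intro powr_mono) auto
    then show ?thesis using one assms by simp
  qed
  then have "a * t powr m0 + b * 1 \<le> a * ?s + b * ?s"
    using one assms by (intro add_mono mult_left_mono) auto
  then have "(a * t powr m0 + b)\<^sup>2 \<le> ((a + b) * ?s)\<^sup>2"
    using assms by (intro power_mono) (auto simp: algebra_simps)
  also have "\<dots> = (a + b)\<^sup>2 * (t + b0) powr (-m)"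
    by (simp add: power_mult_distrib power2_eq_square flip: powr_add)
  finally show ?thesis .
qed

text \<open>Expands the square of \<open>G / sqrt e - sqrt e * d\<close>. The weight
  \<open>e\<close> will be \<open>exp (\<alpha> t)\<close>, so that the dissipated disagreement pays
  for the gradient bound.\<close>

lemma mult_le_Young:
  fixes G d e :: real
  assumes "e > 0" "G\<^sup>2 \<le> H * e"
  shows "G * d \<le> (H + e * d\<^sup>2) / 2"
proof -
  have "0 \<le> (G / sqrt e - sqrt e * d)\<^sup>2" by simp
  also have "\<dots> = G\<^sup>2 / e - 2 * (G * d) + e * d\<^sup>2"
    using assms(1) by (simp add: power2_diff power_mult_distrib power_divide)
  also have "G\<^sup>2 / e \<le> H"
    using assms by (simp add: field_simps)
  finally show ?thesis by simp
qed

text \<open>No integrability of \<open>g\<close>: a non-integrable function has integral \<open>0\<close>, hence the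
  hypothesis \<open>B \<ge> 0\<close>. The regret integrand is such a \<open>g\<close>, since no measurability of the
  selection \<open>xstar\<close> is known.\<close>

lemma integral_le_bound:
  fixes g h :: "real \<Rightarrow> real"
  assumes "h integrable_on S" "\<And>t. t \<in> S \<Longrightarrow> g t \<le> h t" "integral S h \<le> B" "B \<ge> 0"
  shows "integral S g \<le> B"
proof (cases "g integrable_on S")
  case True
  then show ?thesis using integral_le[OF True assms(1,2)] assms(3) by linarith
qed (use assms in \<open>simp add: not_integrable_integral\<close>)

text \<open>Integrability of \<open>dU\<close> comes from the fundamental theorem, as it is an exact
  derivative; continuity is asked only of the majorant \<open>g\<close>.\<close>

lemma integral_derivative_bound:
  fixes U dU g :: "real \<Rightarrow> real"
  assumes "\<And>t. t \<ge> T0 \<Longrightarrow> (U has_real_derivative dU t) (at t within {T0..})"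
    and "\<And>t. t \<ge> T0 \<Longrightarrow> dU t \<le> g t" and "continuous_on {T0..} g" and "T \<ge> T0"
  shows "U T - U T0 \<le> integral {T0..T} g"
proof -
  have "(dU has_integral U T - U T0) {T0..T}"
    using assms(1,4)
    by (intro fundamental_theorem_of_calculus)
      (auto simp: has_real_derivative_iff_has_vector_derivative[symmetric]
        intro: DERIV_subset[of U _ _ "{T0..}"])
  moreover have "g integrable_on {T0..T}"
    by (intro integrable_continuous_real continuous_on_subset[OF assms(3)]) auto
  ultimately show ?thesis
    using assms(2) by (intro has_integral_le[OF _ integrable_integral]) auto
qed

text \<open>The conclusion exposes \<open>a1\<close> and \<open>b1\<close> so that
  \<open>a2\<close>, \<open>b2\<close> are visibly a pair granted by \<open>B6\<close> for the
  growth of this trajectory. The premise in \<open>wmin\<close> covers a single agent, where there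
  is no edge and \<open>Min\<close> is unspecified.\<close>

theorem theorem5:
  fixes f :: "'v::finite \<Rightarrow> real \<Rightarrow> real ^ 'n::finite \<Rightarrow> real"
    and E :: "('v \<times> 'v) set"
    and A :: "real ^ 'v ^ 'v"
    and wmin T0 c0 cdag m0 k1 \<sigma> m b0 :: real
    and xstar xtilde :: "real \<Rightarrow> real ^ 'n"
    and xdag x :: "'v \<Rightarrow> real \<Rightarrow> real ^ 'n"
    and \<alpha> \<beta> :: "real \<Rightarrow> real"
  assumes T0: "T0 \<ge> 0"
    and costs: "admissible_costs T0 f"
    and graph: "connected_weighted_graph E A"
    and wmin_pos: "wmin > 0"
    and wmin: "edge_weights A \<noteq> {} \<Longrightarrow> wmin = Min (edge_weights A)"
    and B1: "c0 > 0"
      "\<And>t. t \<ge> T0 \<Longrightarrow> is_minimizer (global_cost f t) (xstar t) \<and> norm (xstar t) \<le> c0"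
    and B2: "\<And>T. T > T0 \<Longrightarrow>
        is_minimizer (\<lambda>y. integral {T0..T} (\<lambda>t. global_cost f t y)) (xtilde T)"
      "\<exists>c. \<forall>T>T0. norm (xtilde T) \<le> c"
    and B3: "cdag > 0"
      "\<And>i t. t \<ge> T0 \<Longrightarrow> is_minimizer (f i t) (xdag i t) \<and> norm (xdag i t) \<le> cdag"
    and B4: "\<And>R. R > 0 \<Longrightarrow>
        \<exists>M>0. \<forall>i. \<forall>t\<ge>T0. \<forall>y. norm y \<le> R \<longrightarrow> \<bar>f i t y\<bar> \<le> M"
    and B5: "\<exists>C. \<forall>t\<ge>T0. \<forall>Y. \<bar>time_deriv T0 (\<lambda>s. stacked_cost f s Y) t\<bar> \<le> C"
    and B6: "\<And>a1 b1. a1 > 0 \<Longrightarrow> b1 > 0 \<Longrightarrow>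
        \<exists>a2>0. \<exists>b2>0. grad_growth T0 f m0 a1 b1 a2 b2"
    and params: "k1 > 0" "\<sigma> > 0" "m < -1" "m \<le> -2 * m0"
      "b0 \<ge> 1" "b0 > (-m / \<sigma>) powr (1 / (1 - m))"
    and beta: "\<And>t. t \<ge> T0 \<Longrightarrow> exp (\<beta> t) = (t + b0) powr m"
    and alpha: "\<And>t. t \<ge> T0 \<Longrightarrow>
        exp (\<alpha> t) = m * inverse (t + b0) + \<sigma> * (t + b0) powr (-m)"
    and dynamics: "solves_dynamics T0 \<alpha> \<beta> k1 A f x"
  shows "\<exists>c4>0. \<exists>\<rho>>0. \<exists>\<omega>>0. \<exists>a1>0. \<exists>b1>0. \<exists>a2>0. \<exists>b2>0.
      (\<forall>i. \<forall>t>T0. norm (x i t) \<le> a1 * sqrt t + b1) \<and>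
      grad_growth T0 f m0 a1 b1 a2 b2 \<and>
      (\<forall>i. \<forall>t>T0. norm (grad (f i t) (x i t)) \<le> a2 * t powr m0 + b2) \<and>
      (\<forall>T>T0.
        (\<forall>Y. \<forall>t\<in>{T0..T}.
           stacked_cost f t Y - stacked_cost f t (ones_kron (xtilde T)) \<ge> - \<rho>) \<and>
        integral {T0..T} (\<lambda>t.
            exp (\<alpha> t) * (stack (\<lambda>i. x i t) \<bullet>
              (kronecker (laplacian A) (mat 1) *v stack (\<lambda>i. x i t)))
            - \<sigma> * \<rho> / k1) \<le> \<omega> / k1 \<and>
        (let N = real CARD('v);
             \<epsilon>\<^sub>1 = \<sigma> * \<rho> / k1 * (T - T0) + \<omega> / k1;
             \<epsilon>\<^sub>2 = \<rho> / (k1 * b0 powr (-m)) * (T - T0) + \<omega> / (k1 * \<sigma> * b0 powr (-m))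
         in distributed_regret T0 f xstar x T
            \<le> c4 * (T - T0) + \<omega> / \<sigma>
              + N * a2 / sqrt \<sigma> * sqrt (N / wmin * \<epsilon>\<^sub>1)
              + N * b2 * sqrt (N / wmin * \<epsilon>\<^sub>2)))"
proof -

  \<comment> \<open>Continuity along the trajectory\<close>
  have sym: "A $ i $ j = A $ j $ i" and weight_nonneg: "A $ i $ j \<ge> 0" for i j
    using graph unfolding connected_weighted_graph_def by (metis, metis less_eq_real_def)
  have C1: "C1_on (\<lambda>(t, y). f i t y) ({T0..} \<times> UNIV)" for i
    using costs unfolding admissible_costs_def by blast
  obtain v where v: "\<And>i t. t \<ge> T0 \<Longrightarrow> (x i has_vector_derivative v i t) (at t within {T0..})"
    using dynamics unfolding solves_dynamics_def by blast
  have x_cont: "continuous_on {T0..} (x i)" for i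
    by (intro continuous_on_vector_derivative[OF v]) auto
  have cost_cont: "continuous_on {T0..} (\<lambda>t. f i t (x j t))" for i j
    by (intro DERIV_continuous_on[OF C1_on_chain_rule[OF C1 _ v]]) auto
  have cost_cont_0: "continuous_on {T0..} (\<lambda>t. f i t 0)" for i
    by (intro DERIV_continuous_on[OF C1_on_time_deriv[OF C1]]) auto
  have "continuous_on {T0..} (\<lambda>t. m * inverse (t + b0) + \<sigma> * (t + b0) powr (-m))"
    using T0 params(5) by (auto intro!: continuous_intros)
  then have exp_cont: "continuous_on {T0..} (\<lambda>t. exp (\<alpha> t))"
    by (rule continuous_on_eq) (simp add: alpha)

  \<comment> \<open>Uniform bounds from the minimizers\<close>
  obtain c where c: "\<And>T. T > T0 \<Longrightarrow> norm (xtilde T) \<le> c"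
    using B2(2) by blast
  \<comment> \<open>One radius for all three families of minimizers, so that a single
    \<open>M\<close> serves throughout.\<close>
  define R where "R = c0 + cdag + \<bar>c\<bar>"
  have R: "R > 0" "c0 \<le> R" "cdag \<le> R" "c \<le> R"
    using B1(1) B3(1) unfolding R_def by auto
  obtain M where M: "M > 0" "\<And>i t y. t \<ge> T0 \<Longrightarrow> norm y \<le> R \<Longrightarrow> \<bar>f i t y\<bar> \<le> M"
    using B4[OF R(1)] by blast
  \<comment> \<open>A minimizer lies in the ball of radius \<open>R\<close>, so the lower bound
    there extends to the whole space.\<close>
  have lower: "f i t y \<ge> - M" if t: "t \<ge> T0" for i t y
  proof -
    have "f i t (xdag i t) \<le> f i t y" "norm (xdag i t) \<le> R"
      using B3(2)[OF t, of i] R(3) by (auto simp: is_arg_min_linorder)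
    then show ?thesis using M(2)[OF t, of "xdag i t" i] by linarith
  qed
  have upper: "f i t y \<le> M" if "t \<ge> T0" "norm y \<le> R" for i t y
    using M(2)[OF that, of i] by linarith
  define N where "N = real CARD('v)"
  have N: "N > 0" unfolding N_def by simp
  \<comment> \<open>Each of the \<open>N\<close> summands of a cost gap is at least
    \<open>- M - M\<close>.\<close>
  define \<rho> where "\<rho> = 2 * N * M"
  have \<rho>: "\<rho> > 0" using N M(1) unfolding \<rho>_def by simp
  have gap: "(\<Sum>i\<in>UNIV. f i t (y i) - f i t z) \<ge> - \<rho>" if "t \<ge> T0" "norm z \<le> R" for t y z
  proof -
    have "(\<Sum>i\<in>(UNIV::'v set). - (2 * M)) \<le> (\<Sum>i\<in>UNIV. f i t (y i) - f i t z)"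
    proof (rule sum_mono)
      fix i
      show "- (2 * M) \<le> f i t (y i) - f i t z"
        using lower[OF that(1), of i "y i"] upper[OF that, of i] by linarith
    qed
    then show ?thesis unfolding \<rho>_def N_def by simp
  qed

  \<comment> \<open>Energy and dissipation estimates\<close>
  define F where "F t = (\<Sum>i\<in>UNIV. f i t (x i t) - f i t 0)" for t
  define Q where "Q t = (\<Sum>i\<in>UNIV. x i t \<bullet> (\<Sum>j\<in>UNIV. A $ i $ j *\<^sub>R (x i t - x j t)))" for t
  define q where "q t = exp (\<alpha> t) * Q t" for t
  have Q_stack: "stack (\<lambda>i. x i t) \<bullet> (kronecker (laplacian A) (mat 1) *v stack (\<lambda>i. x i t)) = Q t" for t
    unfolding Q_def by (rule stack_laplacian_stack)
  have Q_eq: "(\<Sum>i\<in>UNIV. \<Sum>j\<in>UNIV. A $ i $ j * (norm (x i t - x j t))\<^sup>2) = 2 * Q t" for t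
    using sum_weighted_diff_inner[of "\<lambda>i j. A $ i $ j" "\<lambda>i. x i t" "\<lambda>i. x i t", OF sym]
    unfolding Q_def by (simp add: dot_square_norm)
  have "2 * Q t \<ge> 0" for t
    unfolding Q_eq[symmetric] by (intro sum_nonneg mult_nonneg_nonneg weight_nonneg) auto
  then have q_nonneg: "q t \<ge> 0" for t
    unfolding q_def by simp
  have F_lower: "F t \<ge> - \<rho>" if "t \<ge> T0" for t
    unfolding F_def using gap[OF that, of 0] R(1) by simp
  have F_cont: "continuous_on {T0..} F" and q_cont: "continuous_on {T0..} q"
    unfolding F_def q_def Q_def
    by (intro continuous_intros cost_cont cost_cont_0 exp_cont x_cont)+
  have F_int: "F integrable_on {T0..T}" and q_int: "q integrable_on {T0..T}" for T
    by (intro integrable_continuous_real continuous_on_subset[OF F_cont]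
        continuous_on_subset[OF q_cont]; auto)+

  obtain C where C: "\<And>t Y. t \<ge> T0 \<Longrightarrow> \<bar>time_deriv T0 (\<lambda>s. stacked_cost f s Y) t\<bar> \<le> C"
    using B5 by blast
  obtain U dU where
    dU: "\<And>t. t \<ge> T0 \<Longrightarrow> (U has_real_derivative dU t) (at t within {T0..})" and
    dU_le: "\<And>t. t \<ge> T0 \<Longrightarrow> dU t \<le> - \<sigma> * F t - k1 * exp (\<alpha> t) * Q t" and
    U_ge: "\<And>t. t \<ge> T0 \<Longrightarrow> U t \<ge> exp (\<beta> t) * F t + (\<Sum>i\<in>UNIV. x i t \<bullet> x i t) / 2"
    using lyapunov_dissipation[OF T0 costs sym C params(3,5) beta alpha dynamics params(1) weight_nonneg]
    unfolding F_def Q_def by blast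
  \<comment> \<open>Since \<open>t + b0 \<ge> 1\<close> and \<open>m < 0\<close>,
    \<open>exp (\<beta> t) \<le> 1\<close>; so a negative \<open>F t\<close> costs at most
    \<open>\<rho>\<close>.\<close>
  have U_lower: "U t \<ge> - \<rho> + (\<Sum>i\<in>UNIV. x i t \<bullet> x i t) / 2" if t: "t \<ge> T0" for t
  proof -
    have "(t + b0) powr m \<le> (t + b0) powr 0"
      using t T0 params(3,5) by (intro powr_mono) auto
    then have "exp (\<beta> t) \<le> 1"
      unfolding beta[OF t] using t T0 params(5) by simp
    then have "exp (\<beta> t) * \<rho> \<le> \<rho>"
      using \<rho> by (simp add: mult_le_cancel_right1)
    moreover have "exp (\<beta> t) * - \<rho> \<le> exp (\<beta> t) * F t"
      using F_lower[OF t] by (intro mult_left_mono) auto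
    ultimately show ?thesis using U_ge[OF t] by linarith
  qed
  \<comment> \<open>Bounds the drop \<open>U T0 - U T\<close>, because
    \<open>U T \<ge> - \<rho>\<close>.\<close>
  define \<omega>0 where "\<omega>0 = \<bar>U T0\<bar> + \<rho>"
  have \<omega>0: "\<omega>0 > 0" using \<rho> unfolding \<omega>0_def by linarith
  have U_upper: "U T + \<sigma> * integral {T0..T} F + k1 * integral {T0..T} q \<le> U T0" if "T \<ge> T0" for T
  proof -
    have "U T - U T0 \<le> integral {T0..T} (\<lambda>t. (- \<sigma>) * F t - k1 * q t)"
      using dU_le that by (intro integral_derivative_bound[OF dU] continuous_intros F_cont q_cont)
        (auto simp: q_def mult.assoc)
    also have "\<dots> = - \<sigma> * integral {T0..T} F - k1 * integral {T0..T} q"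
      by (subst integral_diff) (auto intro!: integrable_on_mult_right integrable_neg F_int q_int)
    finally show ?thesis by simp
  qed
  have IF_lower: "integral {T0..T} F \<ge> - \<rho> * (T - T0)" if "T \<ge> T0" for T
    using integral_le[of "\<lambda>_. - \<rho>" "{T0..T}" F, OF integrable_const_ivl F_int] F_lower that
    by (simp add: mult.commute)
  have Iq_nonneg: "integral {T0..T} q \<ge> 0" for T
    by (intro integral_nonneg q_int q_nonneg)
  have energy: "\<sigma> * integral {T0..T} F + k1 * integral {T0..T} q \<le> \<omega>0" if "T \<ge> T0" for T
    using U_upper[OF that] U_lower[OF that] sum_nonneg[of UNIV "\<lambda>i. x i T \<bullet> x i T"]
    unfolding \<omega>0_def by simp
  have IF_upper: "integral {T0..T} F \<le> \<omega>0 / \<sigma>" if "T \<ge> T0" for T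
  proof -
    have "k1 * integral {T0..T} q \<ge> 0" using Iq_nonneg params(1) by simp
    then have "\<sigma> * integral {T0..T} F \<le> \<omega>0" using energy[OF that] by linarith
    then show ?thesis using params(2) by (simp add: field_simps)
  qed
  have Iq_upper: "integral {T0..T} q \<le> (\<omega>0 + \<sigma> * \<rho> * (T - T0)) / k1" if "T \<ge> T0" for T
  proof -
    have "\<sigma> * (- \<rho> * (T - T0)) \<le> \<sigma> * integral {T0..T} F"
      using IF_lower[OF that] params(2) by (intro mult_left_mono) auto
    then have "k1 * integral {T0..T} q \<le> \<omega>0 + \<sigma> * \<rho> * (T - T0)"
      using energy[OF that] by (simp add: mult.assoc)
    then show ?thesis using params(1) by (simp add: field_simps)
  qed

  \<comment> \<open>Growth of the trajectory and its gradients\<close>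
  \<comment> \<open>Read off from \<open>|x|^2 \<le> 2 (U + \<rho>) \<le> 2 \<sigma> \<rho> t + 2
    \<omega>0\<close> and subadditivity of the square root.\<close>
  define a1 b1 where "a1 = sqrt (2 * \<sigma> * \<rho>)" and "b1 = sqrt (2 * \<omega>0)"
  have a1: "a1 > 0" and b1: "b1 > 0"
    using params(2) \<rho> \<omega>0 unfolding a1_def b1_def by auto
  have x_growth: "norm (x i t) \<le> a1 * sqrt t + b1" if "t > T0" for i t
  proof -
    have t: "t \<ge> T0" "t \<ge> 0" using that T0 by auto
    have "\<sigma> * (- \<rho> * (t - T0)) \<le> \<sigma> * integral {T0..t} F"
      using IF_lower[OF t(1)] params(2) by (intro mult_left_mono) auto
    moreover have "k1 * integral {T0..t} q \<ge> 0" using Iq_nonneg params(1) by simp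
    moreover have "0 \<le> \<sigma> * (\<rho> * T0)" using T0 \<rho> params(2) by simp
    ultimately have "U t \<le> \<bar>U T0\<bar> + \<sigma> * \<rho> * t"
      using U_upper[OF t(1)] by (simp add: algebra_simps)
    then have U: "2 * (U t + \<rho>) \<le> 2 * \<sigma> * \<rho> * t + 2 * \<omega>0"
      unfolding \<omega>0_def by (simp add: algebra_simps)
    have "(norm (x i t))\<^sup>2 \<le> (\<Sum>i\<in>UNIV. x i t \<bullet> x i t)"
      unfolding dot_square_norm by (rule member_le_sum) auto
    also have "\<dots> \<le> 2 * (U t + \<rho>)"
      using U_lower[OF t(1)] by simp
    also note U
    finally have "norm (x i t) \<le> sqrt (2 * \<sigma> * \<rho> * t + 2 * \<omega>0)"
      by (rule real_le_rsqrt)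
    also have "\<dots> \<le> sqrt (2 * \<sigma> * \<rho> * t) + sqrt (2 * \<omega>0)"
      using t \<rho> params(2) \<omega>0 by (intro sqrt_add_le_add_sqrt) auto
    finally show ?thesis unfolding a1_def b1_def by (simp add: real_sqrt_mult)
  qed
  obtain a2 b2 where a2: "a2 > 0" and b2: "b2 > 0" and growth: "grad_growth T0 f m0 a1 b1 a2 b2"
    using B6[OF a1 b1] by blast
  \<comment> \<open>\<open>grad_growth\<close> ranges over arbitrary curves, so it also bounds the
    gradient of one agent's cost at another agent's position, as the regret requires.\<close>
  have grad_bound: "norm (grad (f i t) (x j t)) \<le> a2 * t powr m0 + b2" if "t > T0" for i j t
    using growth x_growth that unfolding grad_growth_def by blast

  \<comment> \<open>Cost of disagreement between agents\<close>
  obtain K where K: "K \<ge> 0" and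
    K_le: "\<And>(y :: 'v \<Rightarrow> real ^ 'n) i j. (norm (y i - y j))\<^sup>2
      \<le> K * (\<Sum>k\<in>UNIV. \<Sum>l\<in>UNIV. A $ k $ l * (norm (y k - y l))\<^sup>2)"
    using connected_disagreement_bound[OF graph] by blast
  \<comment> \<open>\<open>\<kappa>\<close> compares \<open>exp (\<alpha> t)\<close> with
    \<open>(t + b0) powr (-m)\<close>; dividing by it makes the squared gradient bound at most
    \<open>H * exp (\<alpha> t)\<close> for \<open>t \<ge> 1\<close>.\<close>
  define \<kappa> where "\<kappa> = \<sigma> + m / b0 powr (1 - m)"
  define H where "H = (a2 + b2)\<^sup>2 / \<kappa>"
  have \<kappa>: "\<kappa> > 0" and \<kappa>_le: "exp (\<alpha> t) \<ge> \<kappa> * (t + b0) powr (-m)" if "t \<ge> T0" for t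
    using scaling_lower_bound[OF params(2,3,5,6), of "t + b0"] that T0
    unfolding \<kappa>_def alpha[OF that] by auto
  have H: "H \<ge> 0" using \<kappa>[of T0] unfolding H_def by simp
  have pair_late: "f i t (x j t) - f i t (x i t) \<le> H / 2 + K * q t" if t: "t \<ge> T0 + 1" for i j t
  proof -
    have t': "t \<ge> T0" "t > T0" "t \<ge> 1" using t T0 by auto
    let ?G = "a2 * t powr m0 + b2" and ?d = "norm (x j t - x i t)"
    have "convex_on UNIV (f i t)"
      using costs t' unfolding admissible_costs_def by blast
    from convex_on_GDERIV_above_tangent[OF this C1_on_GDERIV_grad[OF C1 t'(1)], of "x j t" "x i t"]
    have "f i t (x j t) - f i t (x i t) \<le> grad (f i t) (x j t) \<bullet> (x j t - x i t)"
      by (simp add: inner_diff_right)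
    also have "\<dots> \<le> norm (grad (f i t) (x j t)) * ?d"
      by (rule norm_cauchy_schwarz)
    also have "\<dots> \<le> ?G * ?d"
      by (intro mult_right_mono grad_bound t') auto
    also have "\<dots> \<le> (H + exp (\<alpha> t) * ?d\<^sup>2) / 2"
    proof (rule mult_le_Young)
      have "?G\<^sup>2 \<le> (a2 + b2)\<^sup>2 * (t + b0) powr (-m)"
        using t' params a2 b2 by (intro grad_growth_sq_le)
      also have "(t + b0) powr (-m) \<le> exp (\<alpha> t) / \<kappa>"
        using \<kappa>_le[OF t'(1)] \<kappa>[OF t'(1)] by (simp add: field_simps)
      finally show "?G\<^sup>2 \<le> H * exp (\<alpha> t)"
        unfolding H_def by (simp add: mult_left_mono)
    qed simp
    \<comment> \<open>The edge sum equals \<open>2 * Q t\<close>; this 2 cancels the half in Young's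
      inequality.\<close>
    also have "exp (\<alpha> t) * ?d\<^sup>2 \<le> exp (\<alpha> t) * (K * (2 * Q t))"
      using K_le[of "\<lambda>i. x i t" j i] unfolding Q_eq by (intro mult_left_mono) auto
    finally show ?thesis unfolding q_def by (simp add: add_divide_distrib mult_ac)
  qed
  txt \<open>If \<open>m0 < 0\<close> and \<open>T0 = 0\<close>, the bound \<open>a2 * t powr m0 + b2\<close> blows up at \<open>T0\<close>;
    on the first unit of time it is replaced by compactness.\<close>
  define D where "D t = 1 / N * (\<Sum>j\<in>UNIV. \<Sum>i\<in>UNIV. f i t (x j t)) - (\<Sum>i\<in>UNIV. f i t (x i t))" for t
  have "continuous_on {T0..T0 + 1} D"
    unfolding D_def by (intro continuous_intros continuous_on_subset[OF cost_cont]) auto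
  then have "compact (D ` {T0..T0 + 1})"
    by (intro compact_continuous_image) auto
  then obtain K0 where K0: "\<And>t. t \<in> {T0..T0 + 1} \<Longrightarrow> \<bar>D t\<bar> \<le> K0"
    using compact_imp_bounded bounded_iff by (metis imageI real_norm_def)
  have "K0 \<ge> 0" using K0[of T0] by simp
  have D_late: "D t \<le> N * (H / 2 + K * q t)" if t: "t \<ge> T0 + 1" for t
  proof -
    have "D t = 1 / N * (\<Sum>j\<in>UNIV. \<Sum>i\<in>UNIV. f i t (x j t) - f i t (x i t))"
      unfolding D_def N_def by (simp add: sum_subtractf field_simps)
    also have "\<dots> \<le> 1 / N * (\<Sum>j\<in>(UNIV::'v set). \<Sum>i\<in>(UNIV::'v set). H / 2 + K * q t)"
      using N by (intro mult_left_mono sum_mono pair_late t) auto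
    also have "\<dots> = N * (H / 2 + K * q t)"
      using N unfolding N_def by simp
    finally show ?thesis .
  qed
  have D_le: "D t \<le> K0 + N * H / 2 + N * K * q t" if t: "t \<ge> T0" for t
  proof (cases "t \<ge> T0 + 1")
    case True
    then show ?thesis using D_late[OF True] \<open>K0 \<ge> 0\<close> by (simp add: algebra_simps)
  next
    case False
    moreover have "N * H / 2 \<ge> 0" "N * K * q t \<ge> 0" using N H K q_nonneg by auto
    ultimately show ?thesis using K0[of t] t by auto
  qed

  \<comment> \<open>Regret bound and conclusion\<close>
  \<comment> \<open>Contributions proportional to time go into \<open>c4\<close>, constant ones into
    \<open>\<omega>\<close>, whose factor \<open>\<sigma>\<close> is undone in
    \<open>\<omega> / \<sigma>\<close>.\<close>
  define c4 where "c4 = K0 + N * H / 2 + \<rho> + N * K * \<sigma> * \<rho> / k1"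
  define \<omega> where "\<omega> = \<omega>0 + \<sigma> * N * K * \<omega>0 / k1"
  have c4: "c4 > 0"
    using \<open>K0 \<ge> 0\<close> N H K \<rho> params(1,2) unfolding c4_def by (simp add: add_nonneg_pos add_pos_nonneg)
  have \<omega>: "\<omega> \<ge> \<omega>0" "\<omega> > 0"
    using N K \<omega>0 params(1,2) unfolding \<omega>_def by (auto intro!: add_pos_nonneg)
  have regret: "distributed_regret T0 f xstar x T \<le> c4 * (T - T0) + \<omega> / \<sigma>" if T: "T > T0" for T
    unfolding distributed_regret_def
  proof (rule integral_le_bound)
    let ?h = "\<lambda>t. (K0 + N * H / 2 + \<rho>) + N * K * q t + F t"
    show "?h integrable_on {T0..T}"
      by (intro integrable_add integrable_const_ivl integrable_on_mult_right q_int F_int)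
    have "integral {T0..T} ?h
        = (K0 + N * H / 2 + \<rho>) * (T - T0) + N * K * integral {T0..T} q + integral {T0..T} F"
      using T by (simp add: integral_add integrable_add integrable_on_mult_right q_int F_int
          integrable_const_ivl)
    also have "\<dots> \<le> (K0 + N * H / 2 + \<rho>) * (T - T0)
        + N * K * ((\<omega>0 + \<sigma> * \<rho> * (T - T0)) / k1) + \<omega>0 / \<sigma>"
      using T N K by (intro add_mono mult_left_mono Iq_upper IF_upper order_refl) auto
    also have "\<dots> = c4 * (T - T0) + \<omega> / \<sigma>"
      using params(1,2) unfolding c4_def \<omega>_def by (simp add: field_simps)
    finally show "integral {T0..T} ?h \<le> c4 * (T - T0) + \<omega> / \<sigma>" .
    show "0 \<le> c4 * (T - T0) + \<omega> / \<sigma>"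
      using T c4 \<omega> params(2) by auto
    fix t assume "t \<in> {T0..T}"
    then have t: "t \<ge> T0" by simp
    \<comment> \<open>The regret integrand is \<open>D t + F t\<close> plus the total cost at the
      origin minus that at \<open>xstar t\<close>; \<open>gap\<close> caps this last difference by
      \<open>\<rho>\<close>.\<close>
    have "- \<rho> \<le> (\<Sum>i\<in>UNIV. f i t (xstar t) - f i t 0)"
      using gap[OF t, of 0] R(1) by simp
    then show "1 / real CARD('v) * (\<Sum>j\<in>UNIV. \<Sum>i\<in>UNIV. f i t (x j t))
        - stacked_cost f t (ones_kron (xstar t)) \<le> ?h t"
      using D_le[OF t] unfolding D_def F_def N_def[symmetric] stacked_cost_def ones_kron_def block_stack
      by (simp add: sum_subtractf)
  qed
  show ?thesis
    unfolding Let_def N_def[symmetric] Q_stack q_def[symmetric]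
  proof (rule exI[of _ c4], rule conjI[OF c4], rule exI[of _ \<rho>], rule conjI[OF \<rho>],
      rule exI[of _ \<omega>], rule conjI[OF \<omega>(2)], rule exI[of _ a1], rule conjI[OF a1],
      rule exI[of _ b1], rule conjI[OF b1], rule exI[of _ a2], rule conjI[OF a2],
      rule exI[of _ b2], rule conjI[OF b2], intro conjI allI impI ballI growth)
    show "norm (x i t) \<le> a1 * sqrt t + b1" if "t > T0" for i t
      by (rule x_growth[OF that])
    show "norm (grad (f i t) (x i t)) \<le> a2 * t powr m0 + b2" if "t > T0" for i t
      by (rule grad_bound[OF that])
    fix T assume T: "T > T0"
    show "- \<rho> \<le> stacked_cost f t Y - stacked_cost f t (ones_kron (xtilde T))"
      if "t \<in> {T0..T}" for Y t
      using gap[of t "xtilde T" "block Y"] that c[OF T] R(4)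
      by (simp add: stacked_cost_def ones_kron_def sum_subtractf)
    have "integral {T0..T} (\<lambda>t. q t - \<sigma> * \<rho> / k1) = integral {T0..T} q - \<sigma> * \<rho> / k1 * (T - T0)"
      using T by (simp add: integral_diff q_int integrable_const_ivl)
    also have "\<dots> \<le> \<omega>0 / k1"
      using Iq_upper[of T] T by (simp add: add_divide_distrib)
    also have "\<dots> \<le> \<omega> / k1"
      using \<omega> params(1) by (simp add: divide_right_mono)
    finally show "integral {T0..T} (\<lambda>t. q t - \<sigma> * \<rho> / k1) \<le> \<omega> / k1" .
    \<comment> \<open>\<open>regret\<close> already gives the bound without the two square-root
      terms, so their nonnegativity suffices.\<close>
    have "N * a2 / sqrt \<sigma> * sqrt (N / wmin * (\<sigma> * \<rho> / k1 * (T - T0) + \<omega> / k1)) \<ge> 0"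
      "N * b2 * sqrt (N / wmin * (\<rho> / (k1 * b0 powr (-m)) * (T - T0)
        + \<omega> / (k1 * \<sigma> * b0 powr (-m)))) \<ge> 0"
      using T N a2 b2 wmin_pos params(1,2) \<rho> \<omega>(2) by auto
    then show "distributed_regret T0 f xstar x T \<le> c4 * (T - T0) + \<omega> / \<sigma>
        + N * a2 / sqrt \<sigma> * sqrt (N / wmin * (\<sigma> * \<rho> / k1 * (T - T0) + \<omega> / k1))
        + N * b2 * sqrt (N / wmin * (\<rho> / (k1 * b0 powr (-m)) * (T - T0)
        + \<omega> / (k1 * \<sigma> * b0 powr (-m))))"
      using regret[OF T] by linarith
  qed
qed

end
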